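(* Let $I$ be a nonempty open interval in $\mathbb{R}$. Then $$C^2(I) \subsetneq S^2(I) \subsetneq C^1(I) \subsetneq S^1(I) \subsetneq C^0(I).$$
   Context: For an open interval $I\subset\mathbb{R}$, a function $f:I\to\mathbb{R}$ and a point $x\in I$, the specular derivative of $f$ at $x$ is $$f^{\mathrm{sd}}(x) := \lim_{h \searrow 0} \mathcal{A}(f(x + h) - f(x), f(x) - f(x - h), h)$$ (with $h>0$ small enough that $x\pm h\in I$), where $\mathcal{A}:\mathbb{R}\times\mathbb{R}\times(0,\infty)\to\mathbb{R}$ is $$\mathcal{A}(a, b, c) := \frac{a \sqrt{b^2 + c^2} + b \sqrt{a^2 + c^2}}{c \sqrt{a^2 + c^2} + c \sqrt{b^2 + c^2}}.$$ $f$ is specularly differentiable at $x$ if this limit exists as a finite real number, and specularly differentiable on $I$ if it is so at every point of $I$. $S^0(I)$ is the set of functions $f:I\to\mathbb{R}$ that are specularly differentiable on $I$; $S^1(I):=C^0(I)\cap S^0(I)$; and $S^2(I):=\{f\in S^1(I) \mid f^{\mathrm{sd}}\in S^1(I)\}$. $C^0(I)$, $C^1(I)$, $C^2(I)$ are the usual spaces of continuous, continuously differentiable, and twice continuously differentiable real-valued functions on $I$ (classical derivatives). *)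

theory Defs
  imports "HOL-Analysis.Analysis"
begin

definition specular_A :: "real \<Rightarrow> real \<Rightarrow> real \<Rightarrow> real" where
  "specular_A a b c =
     (a * sqrt (b\<^sup>2 + c\<^sup>2) + b * sqrt (a\<^sup>2 + c\<^sup>2)) /
     (c * sqrt (a\<^sup>2 + c\<^sup>2) + c * sqrt (b\<^sup>2 + c\<^sup>2))"

definition specular_quotient :: "(real \<Rightarrow> real) \<Rightarrow> real \<Rightarrow> real \<Rightarrow> real" where
  "specular_quotient f x h = specular_A (f (x + h) - f x) (f x - f (x - h)) h"

text \<open>Both notions below depend only on the values of \<open>f\<close> near \<open>x\<close>; so for \<open>x\<close> in an
  open interval \<open>I\<close> the values of \<open>f\<close> outside \<open>I\<close> are irrelevant.\<close>

definition specularly_differentiable_at :: "(real \<Rightarrow> real) \<Rightarrow> real \<Rightarrow> bool" where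
  "specularly_differentiable_at f x \<longleftrightarrow> (\<exists>L. (specular_quotient f x \<longlongrightarrow> L) (at_right 0))"

definition specular_deriv :: "(real \<Rightarrow> real) \<Rightarrow> real \<Rightarrow> real" where
  "specular_deriv f x = Lim (at_right 0) (specular_quotient f x)"

text \<open>A function \<open>I \<rightarrow> \<real>\<close> is represented by the element of \<^term>\<open>extensional I\<close> with the same
  values on \<open>I\<close>. The spaces are meant for open \<open>I\<close>.\<close>

primrec C_space :: "nat \<Rightarrow> real set \<Rightarrow> (real \<Rightarrow> real) set" where
  "C_space 0 I = {f \<in> extensional I. continuous_on I f}"
| "C_space (Suc k) I =
     {f \<in> extensional I. (\<forall>x\<in>I. f differentiable (at x)) \<and> restrict (deriv f) I \<in> C_space k I}"

definition S0_space :: "real set \<Rightarrow> (real \<Rightarrow> real) set" where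
  "S0_space I = {f \<in> extensional I. \<forall>x\<in>I. specularly_differentiable_at f x}"

definition S1_space :: "real set \<Rightarrow> (real \<Rightarrow> real) set" where
  "S1_space I = C_space 0 I \<inter> S0_space I"

definition S2_space :: "real set \<Rightarrow> (real \<Rightarrow> real) set" where
  "S2_space I = {f \<in> S1_space I. restrict (specular_deriv f) I \<in> S1_space I}"

end

theory Submission
  imports Defs
begin

text \<open>
  With the one-sided slopes \<open>\<alpha> = a / c\<close> and \<open>\<beta> = b / c\<close>, the number \<open>specular_A a b c\<close> is a
  convex combination of \<open>\<alpha>\<close> and \<open>\<beta>\<close> (geometrically, it is the slope of the line bisecting the
  angle between lines of slopes \<open>\<alpha>\<close> and \<open>\<beta>\<close>). The nontrivial inclusions rest on this fact.

  It lies between the two slopes, so an ordinary derivative is also a specular derivative; this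
  yields the inclusions \<open>C\<^sup>2 \<subseteq> S\<^sup>2\<close> and \<open>C\<^sup>1 \<subseteq> S\<^sup>1\<close>.

  The substantial inclusion is \<open>S\<^sup>2 \<subseteq> C\<^sup>1\<close>. It follows from a mean value inequality
  (\<open>specular_deriv_ge_if_slope_gt\<close>): if a continuous \<open>f\<close> has slope greater than \<open>m\<close> over
  \<open>[a, b]\<close>, then its specular derivative is at least \<open>m\<close> somewhere in between. Indeed
  \<open>g x = f x - m * x\<close> grows from \<open>a\<close> to \<open>b\<close>; at the point \<open>c\<close> where \<open>g\<close> first starts to exceed
  some intermediate level, both one-sided slopes of \<open>f\<close> are at least \<open>m\<close> for arbitrarily small
  steps \<open>h\<close>. If now the specular derivative is continuous at \<open>x\<close>, all slopes of \<open>f\<close> near \<open>x\<close> are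
  squeezed around its value at \<open>x\<close>, that is, \<open>f\<close> is differentiable there with the same derivative.

  The inclusions are strict because of two functions and their antiderivatives, for a point
  \<open>p \<in> I\<close>. The function \<open>\<bar>x - p\<bar>\<close> has opposite one-sided slopes at \<open>p\<close>, hence is specularly but
  not classically differentiable. The odd square root \<open>sqrt (x - p)\<close> has two equal one-sided
  slopes at \<open>p\<close>, which tend to infinity, so that it is continuous but not specularly
  differentiable.
\<close>

section \<open>The specular quotient as a weighted mean of slopes\<close>

lemma specular_A_convex:
  assumes "0 < c"
  obtains t where "0 \<le> t" "t \<le> 1" "specular_A a b c = t * (a / c) + (1 - t) * (b / c)"
proof
  define u v where "u = sqrt (a\<^sup>2 + c\<^sup>2)" and "v = sqrt (b\<^sup>2 + c\<^sup>2)"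
  have pos: "0 < u" "0 < v"
    using assms by (simp_all add: u_def v_def add_nonneg_pos)
  show "0 \<le> v / (u + v)" "v / (u + v) \<le> 1"
    using pos by simp_all
  have "1 - v / (u + v) = u / (u + v)"
    using pos by (simp add: field_simps)
  moreover have "specular_A a b c = (a * v + b * u) / (c * (u + v))"
    by (simp add: specular_A_def u_def v_def distrib_left)
  ultimately show "specular_A a b c = v / (u + v) * (a / c) + (1 - v / (u + v)) * (b / c)"
    using pos assms by (simp add: add_divide_distrib mult.commute)
qed

lemma specular_A_ge_min:
  assumes "0 < c"
  shows "min (a / c) (b / c) \<le> specular_A a b c"
proof -
  obtain t where "0 \<le> t" "t \<le> 1" and t: "specular_A a b c = t * (a / c) + (1 - t) * (b / c)"
    using specular_A_convex[OF assms] .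
  then have "t * min (a / c) (b / c) + (1 - t) * min (a / c) (b / c) \<le> specular_A a b c"
    unfolding t by (intro add_mono mult_left_mono) auto
  then show ?thesis by (simp add: algebra_simps)
qed

lemma specular_A_minus: "specular_A (- a) (- b) c = - specular_A a b c"
  unfolding specular_A_def by (simp add: minus_divide_left)

lemma specular_A_le_max:
  assumes "0 < c"
  shows "specular_A a b c \<le> max (a / c) (b / c)"
  using specular_A_ge_min[OF assms, of "- a" "- b"]
  by (simp only: specular_A_minus minus_divide_left[symmetric] minus_max_eq_min[symmetric] neg_le_iff_le)

lemma specular_quotient_minus:
  "specular_quotient (\<lambda>x. - f x) x h = - specular_quotient f x h"
  unfolding specular_quotient_def by (simp flip: specular_A_minus)

lemma specular_deriv_eqI:
  "(specular_quotient f x \<longlongrightarrow> L) (at_right 0) \<Longrightarrow> specular_deriv f x = L"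
  unfolding specular_deriv_def by (rule tendsto_Lim) simp_all

lemma specular_quotient_tendsto_specular_deriv:
  "specularly_differentiable_at f x \<Longrightarrow>
     (specular_quotient f x \<longlongrightarrow> specular_deriv f x) (at_right 0)"
  using specular_deriv_eqI unfolding specularly_differentiable_at_def by blast

lemma specularly_differentiable_at_minus:
  assumes "specularly_differentiable_at f x"
  shows "specularly_differentiable_at (\<lambda>x. - f x) x"
    and "specular_deriv (\<lambda>x. - f x) x = - specular_deriv f x"
proof -
  have lim: "(specular_quotient (\<lambda>x. - f x) x \<longlongrightarrow> - specular_deriv f x) (at_right 0)"
    using tendsto_minus[OF specular_quotient_tendsto_specular_deriv[OF assms]]
    by (simp flip: specular_quotient_minus)
  then show "specularly_differentiable_at (\<lambda>x. - f x) x"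
    unfolding specularly_differentiable_at_def ..
  show "specular_deriv (\<lambda>x. - f x) x = - specular_deriv f x"
    using lim by (rule specular_deriv_eqI)
qed

lemma specular_quotient_tendsto_cong:
  assumes "open I" "x \<in> I" "\<And>y. y \<in> I \<Longrightarrow> f y = g y"
  shows "(specular_quotient f x \<longlongrightarrow> L) (at_right 0) \<longleftrightarrow>
         (specular_quotient g x \<longlongrightarrow> L) (at_right 0)"
proof (rule tendsto_cong)
  obtain d where d: "0 < d" "ball x d \<subseteq> I"
    using assms(1,2) openE by blast
  have "specular_quotient f x h = specular_quotient g x h" if "0 < h" "h < d" for h
  proof -
    have "{x + h, x - h} \<subseteq> I"
      using that d by (auto simp: dist_real_def)
    then show ?thesis
      using assms by (simp add: specular_quotient_def)
  qed
  then show "\<forall>\<^sub>F h in at_right 0. specular_quotient f x h = specular_quotient g x h"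
    unfolding eventually_at_right_field using d(1) by auto
qed

lemma specularly_differentiable_at_restrict:
  assumes "open I" "x \<in> I"
  shows "specularly_differentiable_at (restrict f I) x \<longleftrightarrow> specularly_differentiable_at f x"
  unfolding specularly_differentiable_at_def
  using specular_quotient_tendsto_cong[OF assms, of "restrict f I" f] by simp

text \<open>The quotient is squeezed between the smaller and the larger of two one-sided slopes, both
  of which tend to the derivative.\<close>

lemma specular_quotient_tendsto_derivative:
  assumes "(f has_real_derivative D) (at x)"
  shows "(specular_quotient f x \<longlongrightarrow> D) (at_right 0)"
proof -
  define r l where "r h = (f (x + h) - f x) / h" and "l h = (f x - f (x - h)) / h" for h
  have lim0: "(r \<longlongrightarrow> D) (at 0)"
    using assms unfolding DERIV_def r_def by simp
  then have r: "(r \<longlongrightarrow> D) (at_right 0)"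
    by (rule tendsto_mono[rotated]) (simp add: at_le)
  have "(r \<longlongrightarrow> D) (at_left 0)"
    using lim0 by (rule tendsto_mono[rotated]) (simp add: at_le)
  then have "((\<lambda>h. r (- h)) \<longlongrightarrow> D) (at_right 0)"
    by (simp add: filterlim_at_left_to_right)
  moreover have "r (- h) = l h" for h
    by (simp add: r_def l_def minus_divide_left flip: minus_divide_right)
  ultimately have l: "(l \<longlongrightarrow> D) (at_right 0)"
    by simp
  have mn: "((\<lambda>h. min (r h) (l h)) \<longlongrightarrow> D) (at_right 0)"
    using tendsto_min[OF r l] by simp
  have mx: "((\<lambda>h. max (r h) (l h)) \<longlongrightarrow> D) (at_right 0)"
    using tendsto_max[OF r l] by simp
  have pos: "\<forall>\<^sub>F h::real in at_right 0. 0 < h"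
    by (simp add: eventually_at_right_less)
  show ?thesis
  proof (rule tendsto_sandwich[OF _ _ mn mx])
    show "\<forall>\<^sub>F h in at_right 0. min (r h) (l h) \<le> specular_quotient f x h"
      using pos by eventually_elim
        (simp only: r_def l_def specular_quotient_def specular_A_ge_min)
    show "\<forall>\<^sub>F h in at_right 0. specular_quotient f x h \<le> max (r h) (l h)"
      using pos by eventually_elim
        (simp only: r_def l_def specular_quotient_def specular_A_le_max)
  qed
qed

section \<open>A mean value inequality and its consequence\<close>

text \<open>The specular derivative of \<open>f x - m * x\<close> is not that of \<open>f\<close> minus \<open>m\<close>, so the inequality
  cannot be reduced to the case \<open>m = 0\<close>. Instead the auxiliary function only serves to find
  points where both one-sided slopes of \<open>f\<close> itself are at least \<open>m\<close>.\<close>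

lemma specular_deriv_ge_if_slope_gt:
  assumes "a < b" and cont: "continuous_on {a..b} f"
    and sd: "\<And>x. x \<in> {a<..<b} \<Longrightarrow> specularly_differentiable_at f x"
    and slope: "m * (b - a) < f b - f a"
  shows "\<exists>c\<in>{a<..<b}. m \<le> specular_deriv f c"
proof -
  define g where "g x = f x - m * x" for x
  define k where "k = (g a + g b) / 2"
  define S where "S = {x \<in> {a..b}. k < g x}"
  define c where "c = Inf S"
  have "g a < g b"
    using slope by (simp add: g_def algebra_simps)
  then have k: "g a < k" "k < g b"
    by (simp_all add: k_def)
  have g_cont: "continuous_on {a..b} g"
    unfolding g_def by (intro continuous_intros cont)
  have bS: "b \<in> S" and bdd: "bdd_below S"
    using \<open>a < b\<close> k by (auto simp: S_def intro: bdd_belowI[of _ a])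
  have c_le: "c \<le> x" if "x \<in> S" for x
    unfolding c_def by (rule cInf_lower[OF that bdd])
  have "a \<le> c"
    unfolding c_def using bS by (intro cInf_greatest) (auto simp: S_def)
  have c: "c \<in> {a..b}"
    using \<open>a \<le> c\<close> c_le[OF bS] by simp
  have near: "\<exists>s\<in>S. s < c + d" if "0 < d" for d
    using cInf_lessD[of S "c + d"] bS that by (auto simp: c_def)
  have "\<not> k < g c"
  proof
    assume "k < g c"
    then have "a < c"
      using k \<open>a \<le> c\<close> by (cases "a = c") auto
    obtain d where "0 < d" and d: "\<And>y. y \<in> {a..b} \<Longrightarrow> dist y c < d \<Longrightarrow> dist (g y) (g c) < g c - k"
      using g_cont c \<open>k < g c\<close> unfolding continuous_on_iff by (metis diff_gt_0_iff_gt)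
    define y where "y = max a (c - d / 2)"
    have y: "y \<in> {a..b}" "y < c" "dist y c < d"
      using c \<open>a < c\<close> \<open>0 < d\<close> by (auto simp: y_def dist_real_def max_def)
    then have "y \<in> S"
      using d[of y] by (auto simp: S_def dist_real_def)
    then show False
      using c_le y(2) by fastforce
  qed
  moreover have "\<not> g c < k"
  proof
    assume "g c < k"
    then obtain d where "0 < d"
      and d: "\<And>y. y \<in> {a..b} \<Longrightarrow> dist y c < d \<Longrightarrow> dist (g y) (g c) < k - g c"
      using g_cont c unfolding continuous_on_iff by (metis diff_gt_0_iff_gt)
    obtain s where s: "s \<in> S" "s < c + d"
      using near[OF \<open>0 < d\<close>] by blast
    then have "dist (g s) (g c) < k - g c"
      using c_le[of s] by (intro d) (auto simp: S_def dist_real_def)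
    then show False
      using s(1) by (auto simp: S_def dist_real_def)
  qed
  ultimately have gc: "g c = k"
    by simp
  have c_in: "c \<in> {a<..<b}"
    using c gc k by (cases "c = a \<or> c = b") auto
  have "m \<le> specular_deriv f c"
  proof (rule ccontr)
    assume "\<not> m \<le> specular_deriv f c"
    then have "\<forall>\<^sub>F h in at_right 0. specular_quotient f c h < m"
      using order_tendstoD(2)[OF specular_quotient_tendsto_specular_deriv[OF sd[OF c_in]]] by simp
    then obtain d where "0 < d" and d: "\<And>h. 0 < h \<Longrightarrow> h < d \<Longrightarrow> specular_quotient f c h < m"
      unfolding eventually_at_right_field by auto
    obtain s where s: "s \<in> S" "s < c + min d (c - a)"
      using near[of "min d (c - a)"] \<open>0 < d\<close> c_in by auto
    define h where "h = s - c"
    have h: "0 < h" "h < d" "h < c - a"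
      using s c_le[OF s(1)] gc by (cases "s = c"; auto simp: h_def S_def)+
    have "m \<le> (f (c + h) - f c) / h"
      using s(1) gc h(1) by (simp add: pos_le_divide_eq S_def g_def h_def algebra_simps)
    moreover have "g (c - h) \<le> k"
      using c_le[of "c - h"] h c by (force simp: S_def)
    then have "m \<le> (f c - f (c - h)) / h"
      using gc h(1) by (simp add: pos_le_divide_eq g_def algebra_simps)
    ultimately have "m \<le> specular_quotient f c h"
      using specular_A_ge_min[OF h(1)] unfolding specular_quotient_def
      by (meson min.boundedI order_trans)
    then show False
      using d h by fastforce
  qed
  then show ?thesis
    using c_in by blast
qed

lemma specular_deriv_le_if_slope_lt:
  assumes "a < b" and "continuous_on {a..b} f"
    and sd: "\<And>x. x \<in> {a<..<b} \<Longrightarrow> specularly_differentiable_at f x"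
    and "f b - f a < m * (b - a)"
  shows "\<exists>c\<in>{a<..<b}. specular_deriv f c \<le> m"
proof -
  have "\<exists>c\<in>{a<..<b}. - m \<le> specular_deriv (\<lambda>x. - f x) c"
    using assms
    by (intro specular_deriv_ge_if_slope_gt specularly_differentiable_at_minus continuous_intros) auto
  then show ?thesis
    using sd by (auto simp: specularly_differentiable_at_minus)
qed

text \<open>If the specular derivative stays within \<open>e\<close> of its value \<open>L\<close> at \<open>x\<close>, then by the mean value
  inequalities so does every slope of \<open>f\<close> in that neighbourhood, in particular those at \<open>x\<close>.\<close>

lemma has_real_derivative_if_specular_deriv_continuous:
  assumes "open I" "x \<in> I" and cont: "continuous_on I f"
    and sd: "\<And>y. y \<in> I \<Longrightarrow> specularly_differentiable_at f y"
    and sd_cont: "continuous_on I (specular_deriv f)"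
  shows "(f has_real_derivative specular_deriv f x) (at x)"
proof -
  define L where "L = specular_deriv f x"
  have "((\<lambda>y. (f y - f x) / (y - x)) \<longlongrightarrow> L) (at x)"
  proof (rule tendstoI)
    fix e :: real
    assume "0 < e"
    obtain d1 where d1: "0 < d1" "ball x d1 \<subseteq> I"
      using assms(1,2) openE by blast
    obtain d2 where "0 < d2"
      and d2: "\<And>y. y \<in> I \<Longrightarrow> dist y x < d2 \<Longrightarrow> dist (specular_deriv f y) L < e / 2"
      using sd_cont \<open>x \<in> I\<close> \<open>0 < e\<close> unfolding continuous_on_iff L_def by (meson half_gt_zero)
    define d where "d = min d1 d2"
    have I: "y \<in> I" if "dist y x < d" for y
      using that d1(2) by (auto simp: d_def dist_commute)
    have near: "\<bar>specular_deriv f y - L\<bar> < e / 2" if "dist y x < d" for y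
      using d2[OF I[OF that]] that by (simp add: d_def dist_real_def)
    have slope: "\<bar>(f b - f a) / (b - a) - L\<bar> \<le> e / 2"
      if "a < b" and ab: "dist a x < d" "dist b x < d" for a b
    proof -
      have sub: "dist y x < d" if "y \<in> {a..b}" for y
        using ab that by (auto simp: dist_real_def)
      have c: "continuous_on {a..b} f"
        using continuous_on_subset[OF cont] sub I by blast
      have s: "specularly_differentiable_at f y" if "y \<in> {a<..<b}" for y
        using sd[OF I[OF sub]] that by simp
      have bounds: "L - e / 2 < specular_deriv f y" "specular_deriv f y < L + e / 2"
        if "y \<in> {a<..<b}" for y
        using near[OF sub[of y]] that by (auto simp: abs_real_def split: if_splits)
      have "\<not> (L + e / 2) * (b - a) < f b - f a"
        using specular_deriv_ge_if_slope_gt[OF \<open>a < b\<close> c s, of "L + e / 2"] bounds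
        by (meson not_less)
      moreover have "\<not> f b - f a < (L - e / 2) * (b - a)"
        using specular_deriv_le_if_slope_lt[OF \<open>a < b\<close> c s, of "L - e / 2"] bounds
        by (meson not_less)
      ultimately have "(f b - f a) / (b - a) \<le> L + e / 2" "L - e / 2 \<le> (f b - f a) / (b - a)"
        using \<open>a < b\<close> by (simp_all add: pos_divide_le_eq pos_le_divide_eq)
      then show ?thesis by linarith
    qed
    have "0 < d"
      using d1 \<open>0 < d2\<close> by (simp add: d_def)
    have "dist ((f y - f x) / (y - x)) L < e" if "y \<noteq> x" "dist y x < d" for y
    proof (cases "x < y")
      case True
      then show ?thesis
        using slope[of x y] that \<open>0 < e\<close> \<open>0 < d\<close> by (simp add: dist_real_def)
    next
      case False
      moreover have "(f y - f x) / (y - x) = (f x - f y) / (x - y)"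
        by (metis minus_diff_eq minus_divide_divide)
      ultimately show ?thesis
        using slope[of y x] that \<open>0 < e\<close> \<open>0 < d\<close> by (simp add: dist_real_def)
    qed
    then show "\<forall>\<^sub>F y in at x. dist ((f y - f x) / (y - x)) L < e"
      using \<open>0 < d\<close> unfolding eventually_at by auto
  qed
  then show ?thesis
    unfolding L_def by (simp add: has_field_derivative_iff)
qed

section \<open>Membership in the function spaces\<close>

lemma C_space_1_iff:
  "f \<in> C_space 1 I \<longleftrightarrow> f \<in> extensional I \<and>
     (\<forall>x\<in>I. f differentiable (at x)) \<and> continuous_on I (deriv f)"
  unfolding One_nat_def C_space.simps by (simp cong: continuous_on_cong)

lemma S1_space_iff:
  "f \<in> S1_space I \<longleftrightarrow> f \<in> extensional I \<and> continuous_on I f \<and>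
     (\<forall>x\<in>I. specularly_differentiable_at f x)"
  by (auto simp: S1_space_def S0_space_def)

lemma differentiable_imp_specular:
  fixes f :: "real \<Rightarrow> real"
  assumes "f differentiable (at x)"
  shows "specularly_differentiable_at f x" and "specular_deriv f x = deriv f x"
proof -
  have lim: "(specular_quotient f x \<longlongrightarrow> deriv f x) (at_right 0)"
    using assms by (intro specular_quotient_tendsto_derivative)
      (simp add: DERIV_deriv_iff_real_differentiable)
  then show "specularly_differentiable_at f x"
    unfolding specularly_differentiable_at_def ..
  show "specular_deriv f x = deriv f x"
    using lim by (rule specular_deriv_eqI)
qed

lemma C1_subset_S1: "C_space 1 I \<subseteq> S1_space I"
  unfolding C_space_1_iff S1_space_iff subset_iff
  by (auto intro!: differentiable_imp_specular continuous_at_imp_continuous_on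
      differentiable_imp_continuous_within)

lemma restrict_specular_deriv_eq:
  assumes "f \<in> C_space 1 I"
  shows "restrict (specular_deriv f) I = restrict (deriv f) I"
  using assms unfolding C_space_1_iff
  by (intro restrict_ext) (simp add: differentiable_imp_specular)

text \<open>On \<open>C\<^sup>1\<close> functions the specular derivative is the classical one, so membership in either
  second-order space is a condition on the classical derivative.\<close>

lemma S2_space_iff_C1:
  assumes "f \<in> C_space 1 I"
  shows "f \<in> S2_space I \<longleftrightarrow> restrict (deriv f) I \<in> S1_space I"
  using assms C1_subset_S1 unfolding S2_space_def
  by (auto simp: restrict_specular_deriv_eq)

lemma C2_iff_C1:
  "f \<in> C_space 2 I \<longleftrightarrow> f \<in> C_space 1 I \<and> restrict (deriv f) I \<in> C_space 1 I"
proof -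
  have "C_space 1 I \<subseteq> C_space 0 I"
    using C1_subset_S1 unfolding S1_space_def by blast
  then show ?thesis
    unfolding numeral_2_eq_2 One_nat_def by (auto simp only: C_space.simps(2) mem_Collect_eq)
qed

lemma S2_subset_C1:
  assumes "open I"
  shows "S2_space I \<subseteq> C_space 1 I"
proof
  fix f
  assume "f \<in> S2_space I"
  then have f: "f \<in> extensional I" "continuous_on I f"
      "\<And>x. x \<in> I \<Longrightarrow> specularly_differentiable_at f x"
    and "continuous_on I (restrict (specular_deriv f) I)"
    unfolding S2_space_def S1_space_iff by auto
  then have sd: "continuous_on I (specular_deriv f)"
    by (simp cong: continuous_on_cong)
  have D: "(f has_real_derivative specular_deriv f x) (at x)" if "x \<in> I" for x
    using that assms f sd by (intro has_real_derivative_if_specular_deriv_continuous)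
  then have "deriv f x = specular_deriv f x" if "x \<in> I" for x
    using that by (intro DERIV_imp_deriv)
  then have "continuous_on I (deriv f)"
    using sd by (simp cong: continuous_on_cong)
  then show "f \<in> C_space 1 I"
    unfolding C_space_1_iff using f D by (auto simp: real_differentiable_def)
qed

lemma restrict_antiderivative:
  assumes "open I" and D: "\<And>x. (F has_real_derivative G x) (at x)" and "continuous_on I G"
  shows "restrict F I \<in> C_space 1 I"
    and "restrict (deriv (restrict F I)) I = restrict G I"
proof -
  have D': "(restrict F I has_real_derivative G x) (at x)" if "x \<in> I" for x
    using has_field_derivative_transform_within_open[OF D \<open>open I\<close> that] by simp
  then have eq: "deriv (restrict F I) x = G x" if "x \<in> I" for x
    using that by (simp add: DERIV_imp_deriv)
  show "restrict F I \<in> C_space 1 I"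
    unfolding C_space_1_iff using D' eq assms(3)
    by (auto simp: real_differentiable_def cong: continuous_on_cong)
  show "restrict (deriv (restrict F I)) I = restrict G I"
    using eq by (intro restrict_ext)
qed

section \<open>Functions separating the spaces\<close>

lemma abs_has_derivative_away_from_0:
  fixes x p :: real
  assumes "x \<noteq> p"
  shows "((\<lambda>x. \<bar>x - p\<bar>) has_real_derivative sgn (x - p)) (at x)"
proof -
  define s where "s = sgn (x - p)"
  define U where "U = (if p < x then {p<..} else {..<p})"
  have U: "open U" "x \<in> U"
    using assms by (auto simp: U_def)
  have eq: "s * (y - p) = \<bar>y - p\<bar>" if "y \<in> U" for y
    using assms that by (auto simp: U_def s_def split: if_splits)
  have "((\<lambda>y. s * (y - p)) has_real_derivative s) (at x)"
    by (auto intro!: derivative_eq_intros)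
  then show ?thesis
    unfolding s_def[symmetric] using U eq by (rule has_field_derivative_transform_within_open)
qed

lemma abs_restrict_in_S1:
  assumes "open I"
  shows "restrict (\<lambda>x. \<bar>x - p\<bar>) I \<in> S1_space I"
proof -
  have "specularly_differentiable_at (\<lambda>x. \<bar>x - p\<bar>) x" for x
  proof (cases "x = p")
    case True
    have "specular_quotient (\<lambda>x. \<bar>x - p\<bar>) p = (\<lambda>h. 0)"
      by (auto simp: specular_quotient_def specular_A_def)
    with True show ?thesis
      unfolding specularly_differentiable_at_def by auto
  next
    case False
    then show ?thesis
      using abs_has_derivative_away_from_0 specular_quotient_tendsto_derivative
      unfolding specularly_differentiable_at_def by blast
  qed
  moreover have "continuous_on I (\<lambda>x. \<bar>x - p\<bar>)"
    by (intro continuous_intros)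
  ultimately show ?thesis
    unfolding S1_space_iff
    by (auto simp: specularly_differentiable_at_restrict assms cong: continuous_on_cong)
qed

lemma abs_restrict_notin_C1:
  assumes "open I" "p \<in> I"
  shows "restrict (\<lambda>x. \<bar>x - p\<bar>) I \<notin> C_space 1 I"
proof
  assume "restrict (\<lambda>x. \<bar>x - p\<bar>) I \<in> C_space 1 I"
  then have "restrict (\<lambda>x. \<bar>x - p\<bar>) I differentiable (at p)"
    unfolding C_space_1_iff using \<open>p \<in> I\<close> by blast
  then obtain D where "(restrict (\<lambda>x. \<bar>x - p\<bar>) I has_real_derivative D) (at p)"
    unfolding real_differentiable_def by blast
  then have D: "((\<lambda>x. \<bar>x - p\<bar>) has_real_derivative D) (at p)"
    using has_field_derivative_transform_within_open[OF _ assms] by fastforce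
  \<comment> \<open>A minimum at \<open>p\<close> forces \<open>D = 0\<close>, but the slopes at \<open>p\<close> all have absolute value 1.\<close>
  have "D = 0"
    using DERIV_local_min[OF D zero_less_one] by simp
  with D have "((\<lambda>h::real. \<bar>h\<bar> / h) \<longlongrightarrow> 0) (at 0)"
    by (simp add: DERIV_def)
  then have "((\<lambda>h::real. \<bar>\<bar>h\<bar> / h\<bar>) \<longlongrightarrow> 0) (at 0)"
    by (rule tendsto_rabs_zero)
  moreover have "\<forall>\<^sub>F h::real in at 0. \<bar>\<bar>h\<bar> / h\<bar> = 1"
    by (auto simp: eventually_at_filter)
  ultimately have "((\<lambda>h::real. 1::real) \<longlongrightarrow> 0) (at 0)"
    by (rule Lim_transform_eventually)
  then show False
    by (simp add: tendsto_const_iff)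
qed

lemma abs_antiderivative:
  "((\<lambda>x. (x - p) * \<bar>x - p\<bar> / 2) has_real_derivative \<bar>x - p\<bar>) (at x)"
proof (cases "x = p")
  case True
  have "((\<lambda>h. \<bar>h\<bar> / 2) \<longlongrightarrow> (0::real)) (at 0)"
    by (auto intro!: tendsto_eq_intros)
  moreover have "(\<lambda>h::real. h * \<bar>h\<bar> / 2 / h) = (\<lambda>h. \<bar>h\<bar> / 2)"
    by auto
  ultimately have "((\<lambda>h::real. h * \<bar>h\<bar> / 2 / h) \<longlongrightarrow> 0) (at 0)"
    by (simp only:)
  with True show ?thesis
    by (simp add: DERIV_def)
next
  case False
  have "((\<lambda>x. x - p) has_real_derivative 1) (at x)"
    by (auto intro!: derivative_eq_intros)
  from DERIV_cdivide[OF DERIV_mult[OF this abs_has_derivative_away_from_0[OF False]], of 2]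
  have "((\<lambda>x. (x - p) * \<bar>x - p\<bar> / 2) has_real_derivative
      (\<bar>x - p\<bar> + sgn (x - p) * (x - p)) / 2) (at x)"
    by (simp only: mult_1)
  moreover have "sgn (x - p) * (x - p) = \<bar>x - p\<bar>"
    by (simp add: abs_sgn mult.commute)
  ultimately show ?thesis
    by simp
qed

text \<open>Since \<^const>\<open>sqrt\<close> is odd, both one-sided slopes at \<open>p\<close> agree with the specular quotient,
  which is \<open>1 / sqrt h\<close> and thus unbounded.\<close>

lemma sqrt_not_specularly_differentiable:
  "\<not> specularly_differentiable_at (\<lambda>x. sqrt (x - p)) p"
proof
  assume "specularly_differentiable_at (\<lambda>x. sqrt (x - p)) p"
  then obtain L where L: "(specular_quotient (\<lambda>x. sqrt (x - p)) p \<longlongrightarrow> L) (at_right 0)"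
    unfolding specularly_differentiable_at_def by blast
  have eq: "specular_quotient (\<lambda>x. sqrt (x - p)) p h * sqrt h = 1" if "0 < h" for h
  proof -
    have "specular_quotient (\<lambda>x. sqrt (x - p)) p h = specular_A (sqrt h) (sqrt h) h"
      by (simp add: specular_quotient_def real_sqrt_minus)
    also have "\<dots> = sqrt h / h"
      using specular_A_ge_min[OF that, of "sqrt h" "sqrt h"]
        specular_A_le_max[OF that, of "sqrt h" "sqrt h"] by simp
    finally show ?thesis
      using that by simp
  qed
  have "((\<lambda>h. specular_quotient (\<lambda>x. sqrt (x - p)) p h * sqrt h) \<longlongrightarrow> L * sqrt 0) (at_right 0)"
    by (intro tendsto_mult L tendsto_real_sqrt tendsto_ident_at)
  moreover have "\<forall>\<^sub>F h in at_right 0. specular_quotient (\<lambda>x. sqrt (x - p)) p h * sqrt h = 1"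
    using eventually_at_right_less by eventually_elim (rule eq)
  ultimately have "((\<lambda>h::real. 1::real) \<longlongrightarrow> L * sqrt 0) (at_right 0)"
    by (rule Lim_transform_eventually)
  then show False
    by (simp add: tendsto_const_iff)
qed

lemma sqrt_restrict_notin_S1:
  assumes "open I" "p \<in> I"
  shows "restrict (\<lambda>x. sqrt (x - p)) I \<notin> S1_space I"
  using specularly_differentiable_at_restrict[OF assms] sqrt_not_specularly_differentiable assms(2)
  unfolding S1_space_iff by blast

lemma sqrt_antiderivative:
  "((\<lambda>x. 2 / 3 * ((x - p) * sqrt (x - p))) has_real_derivative sqrt (x - p)) (at x)"
proof (cases "x = p")
  case True
  have "((\<lambda>h. 2 / 3 * sqrt h) \<longlongrightarrow> (0::real)) (at 0)"
    by (auto intro!: tendsto_eq_intros)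
  moreover have "(\<lambda>h. 2 / 3 * (h * sqrt h) / h) = (\<lambda>h. 2 / 3 * sqrt h)"
    by auto
  ultimately have "((\<lambda>h. 2 / 3 * (h * sqrt h) / h) \<longlongrightarrow> 0) (at 0)"
    by (simp only:)
  with True show ?thesis
    by (simp add: DERIV_def)
next
  case False
  define r where "r = sqrt (x - p)"
  define s where "s = (if p < x then inverse r / 2 else - inverse r / 2)"
  have "(sqrt has_real_derivative s) (at (x - p))"
    using False by (intro DERIV_real_sqrt_generic) (simp_all add: s_def r_def)
  then have "((\<lambda>x. sqrt (x - p)) has_real_derivative s * 1) (at x)"
    by (rule DERIV_chain2) (auto intro!: derivative_eq_intros)
  then have sqrt: "((\<lambda>x. sqrt (x - p)) has_real_derivative s) (at x)"
    by simp
  have "((\<lambda>x. 2 / 3 * ((x - p) * sqrt (x - p))) has_real_derivative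
      2 / 3 * (r + (x - p) * s)) (at x)"
    by (rule derivative_eq_intros sqrt refl)+ (simp add: r_def algebra_simps)
  moreover have "(x - p) * s = r / 2"
  proof -
    have "r \<noteq> 0" "x - p = (if p < x then r * r else - (r * r))"
      using False by (simp_all add: r_def)
    then show ?thesis
      unfolding s_def by (simp only: split: if_splits) simp_all
  qed
  then have "2 / 3 * (r + (x - p) * s) = sqrt (x - p)"
    by (simp add: r_def)
  ultimately show ?thesis
    by simp
qed

section \<open>The chain of strict inclusions\<close>

theorem theorem6p4:
  fixes I :: "real set"
  assumes "open I" and "is_interval I" and "I \<noteq> {}"
  shows "C_space 2 I \<subset> S2_space I \<and> S2_space I \<subset> C_space 1 I \<and>
         C_space 1 I \<subset> S1_space I \<and> S1_space I \<subset> C_space 0 I"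
proof (intro conjI)
  obtain p where p: "p \<in> I"
    using assms(3) by blast
  let ?abs = "\<lambda>x. \<bar>x - p\<bar>" and ?sqrt = "\<lambda>x. sqrt (x - p)"
  have cont: "continuous_on I ?abs" "continuous_on I ?sqrt"
    by (intro continuous_intros)+
  note abs_int = restrict_antiderivative[OF assms(1) abs_antiderivative cont(1)]
  note sqrt_int = restrict_antiderivative[OF assms(1) sqrt_antiderivative cont(2)]
  show "C_space 2 I \<subset> S2_space I"
  proof
    show "C_space 2 I \<subseteq> S2_space I"
      using C1_subset_S1 by (meson C2_iff_C1 S2_space_iff_C1 subset_iff)
    have "restrict (\<lambda>x. (x - p) * \<bar>x - p\<bar> / 2) I \<in> S2_space I"
      using abs_int abs_restrict_in_S1[OF assms(1)] by (simp only: S2_space_iff_C1)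
    moreover have "restrict (\<lambda>x. (x - p) * \<bar>x - p\<bar> / 2) I \<notin> C_space 2 I"
      using abs_int abs_restrict_notin_C1[OF assms(1) p] by (simp only: C2_iff_C1 simp_thms)
    ultimately show "C_space 2 I \<noteq> S2_space I"
      by blast
  qed
  show "S2_space I \<subset> C_space 1 I"
    using S2_subset_C1[OF assms(1)] sqrt_int sqrt_restrict_notin_S1[OF assms(1) p]
    by (metis S2_space_iff_C1 psubsetI)
  show "C_space 1 I \<subset> S1_space I"
    using C1_subset_S1 abs_restrict_in_S1 abs_restrict_notin_C1 assms(1) p by blast
  have "restrict ?sqrt I \<in> C_space 0 I"
    using cont(2) by (simp cong: continuous_on_cong)
  then show "S1_space I \<subset> C_space 0 I"
    using sqrt_restrict_notin_S1[OF assms(1) p] unfolding S1_space_def by blast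
qed

end
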